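(* Let $(A,\circ,h)$ be a Euclidean metrized commutative algebra. Let $0\ne z\in A$ satisfy $z\circ z=0$. For $0\neq y\in A$ not in the span of $z$, $\mathcal{K}(z,y)\le0$, with equality if and only if $z\circ y=0$. In particular, $A$ contains no nonzero element $z$ with $z\circ z=0$ if either of the following conditions holds: (1) $(A,\circ,h)$ has positive sectional nonassociativity. (2) $(A,\circ,h)$ has nonnegative sectional nonassociativity and is semisimple.
   Context: An algebra is a finite-dimensional vector space with a bilinear multiplication. A Euclidean metrized commutative algebra is a real commutative algebra $(A,\circ)$ with a positive definite symmetric bilinear form $h$ that is invariant: $h(x\circ y,z)=h(x,y\circ z)$ for all $x,y,z$. Sectional nonassociativity is defined for algebras of dimension at least $2$: for linearly independent $x,y$, $$\mathcal{K}(x,y)=\frac{h(x\circ x,y\circ y)-h(x\circ y,y\circ x)}{h(x,x)h(y,y)-h(x,y)^2}.$$ The algebra has positive (resp. nonnegative) sectional nonassociativity if $\mathcal{K}(x,y)>0$ (resp. $\ge0$) for all linearly independent $x,y$. Semisimple means a direct sum of simple ideals (simple: nonzero multiplication and no proper nonzero ideals). *)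

theory Defs
  imports "HOL-Analysis.Analysis"
begin

text \<open>The multiplication and the form are explicit arguments on a type of class
  \<open>real_vector\<close>, so the form is independent of any inner product the type may carry and
  the algebra of dimension zero is included.\<close>

definition finite_dimensional :: "'a::real_vector itself \<Rightarrow> bool" where
  "finite_dimensional _ \<longleftrightarrow> (\<exists>B :: 'a set. finite B \<and> span B = UNIV)"

definition comm_algebra :: "('a::real_vector \<Rightarrow> 'a \<Rightarrow> 'a) \<Rightarrow> bool" where
  "comm_algebra mul \<longleftrightarrow>
     finite_dimensional TYPE('a) \<and> bilinear mul \<and> (\<forall>x y. mul x y = mul y x)"

definition euclidean_metrized_comm_algebra ::
  "('a::real_vector \<Rightarrow> 'a \<Rightarrow> 'a) \<Rightarrow> ('a \<Rightarrow> 'a \<Rightarrow> real) \<Rightarrow> bool" where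
  "euclidean_metrized_comm_algebra mul h \<longleftrightarrow>
     comm_algebra mul \<and>
     bilinear h \<and> (\<forall>x y. h x y = h y x) \<and> (\<forall>x. x \<noteq> 0 \<longrightarrow> h x x > 0) \<and>
     (\<forall>x y z. h (mul x y) z = h x (mul y z))"

definition sect_nonassoc ::
  "('a::real_vector \<Rightarrow> 'a \<Rightarrow> 'a) \<Rightarrow> ('a \<Rightarrow> 'a \<Rightarrow> real) \<Rightarrow> 'a \<Rightarrow> 'a \<Rightarrow> real" where
  "sect_nonassoc mul h x y =
     (h (mul x x) (mul y y) - h (mul x y) (mul y x)) / (h x x * h y y - (h x y)\<^sup>2)"

definition lin_indep_pair :: "'a::real_vector \<Rightarrow> 'a \<Rightarrow> bool" where
  "lin_indep_pair x y \<longleftrightarrow> x \<noteq> y \<and> independent {x, y}"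

text \<open>Sectional nonassociativity is only defined in dimension at least two. The dimension
  bound is essential: the sign conditions hold vacuously in dimension at most one, for
  instance for the line with zero multiplication.\<close>

definition positive_sect_nonassoc ::
  "('a::real_vector \<Rightarrow> 'a \<Rightarrow> 'a) \<Rightarrow> ('a \<Rightarrow> 'a \<Rightarrow> real) \<Rightarrow> bool" where
  "positive_sect_nonassoc mul h \<longleftrightarrow>
     dim (UNIV :: 'a set) \<ge> 2 \<and>
     (\<forall>x y. lin_indep_pair x y \<longrightarrow> sect_nonassoc mul h x y > 0)"

definition nonnegative_sect_nonassoc ::
  "('a::real_vector \<Rightarrow> 'a \<Rightarrow> 'a) \<Rightarrow> ('a \<Rightarrow> 'a \<Rightarrow> real) \<Rightarrow> bool" where
  "nonnegative_sect_nonassoc mul h \<longleftrightarrow>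
     dim (UNIV :: 'a set) \<ge> 2 \<and>
     (\<forall>x y. lin_indep_pair x y \<longrightarrow> sect_nonassoc mul h x y \<ge> 0)"

text \<open>\<open>alg_ideal mul S I\<close>: \<open>I\<close> is a two-sided ideal of the algebra with carrier \<open>S\<close>.\<close>

definition alg_ideal :: "('a::real_vector \<Rightarrow> 'a \<Rightarrow> 'a) \<Rightarrow> 'a set \<Rightarrow> 'a set \<Rightarrow> bool" where
  "alg_ideal mul S I \<longleftrightarrow>
     subspace I \<and> I \<subseteq> S \<and> (\<forall>x\<in>S. \<forall>y\<in>I. mul x y \<in> I \<and> mul y x \<in> I)"

text \<open>Simplicity of \<open>S\<close> as an algebra in its own right, so its ideals are those of \<open>S\<close>
  and not of the ambient algebra.\<close>

definition simple_algebra :: "('a::real_vector \<Rightarrow> 'a \<Rightarrow> 'a) \<Rightarrow> 'a set \<Rightarrow> bool" where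
  "simple_algebra mul S \<longleftrightarrow>
     (\<exists>x\<in>S. \<exists>y\<in>S. mul x y \<noteq> 0) \<and>
     (\<forall>J. alg_ideal mul S J \<longrightarrow> J = {0} \<or> J = S)"

definition internal_direct_sum :: "'a::real_vector set set \<Rightarrow> bool" where
  "internal_direct_sum F \<longleftrightarrow>
     finite F \<and> (\<forall>x. \<exists>!c. c \<in> (\<Pi>\<^sub>E I\<in>F. I) \<and> x = (\<Sum>I\<in>F. c I))"

text \<open>A set of ideals, rather than an indexed family, suffices because simple summands
  are nonzero, so those of a direct sum are pairwise distinct. The empty sum makes the algebra
  of dimension zero semisimple.\<close>

definition semisimple_algebra :: "('a::real_vector \<Rightarrow> 'a \<Rightarrow> 'a) \<Rightarrow> bool" where
  "semisimple_algebra mul \<longleftrightarrow>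
     (\<exists>F. (\<forall>I\<in>F. alg_ideal mul UNIV I \<and> simple_algebra mul I) \<and> internal_direct_sum F)"

end

theory Submission
  imports Defs
begin

text \<open>If \<open>z \<circ> z = 0\<close>, the first term in the numerator of \<open>\<K>(z, y)\<close> vanishes and what is left
  is \<open>- h(z \<circ> y, z \<circ> y)\<close>, while the denominator is positive by the strict Cauchy-Schwarz
  inequality (\<open>gram_determinant_pos\<close>). Positive definiteness of \<open>h\<close> then gives the sign and the
  equality case (\<open>sect_nonassoc_square_zero\<close>).

  In dimension at least two a vector \<open>y\<close> outside the line through \<open>z\<close> exists, so positivity is
  contradicted at once. If \<open>\<K>\<close> is only nonnegative, the equality case forces \<open>z \<circ> y = 0\<close> for every
  such \<open>y\<close>, so that \<open>z\<close> annihilates the algebra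
  (\<open>square_zero_annihilates\<close>). A semisimple algebra excludes this
  (\<open>semisimple_annihilator_trivial\<close>): invariance makes an annihilating \<open>z\<close> orthogonal to every
  product, and in a simple ideal the products generate everything, so \<open>z\<close> is orthogonal to all
  summands and hence to itself.\<close>

lemma gram_determinant_pos:
  fixes h :: "'a::real_vector \<Rightarrow> 'a \<Rightarrow> real"
  assumes "bilinear h" and sym: "\<And>x y. h x y = h y x" and pos: "\<And>x. x \<noteq> 0 \<Longrightarrow> h x x > 0"
    and "z \<noteq> 0" and "y \<notin> span {z}"
  shows "h z z * h y y - (h z y)\<^sup>2 > 0"
proof -
  note bil = bilinear_lsub[OF \<open>bilinear h\<close>] bilinear_rsub[OF \<open>bilinear h\<close>]
    bilinear_lmul[OF \<open>bilinear h\<close>] bilinear_rmul[OF \<open>bilinear h\<close>]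
  have zz: "h z z > 0" using pos \<open>z \<noteq> 0\<close> .
  \<comment> \<open>The component of \<open>y\<close> orthogonal to \<open>z\<close>, scaled by \<open>h z z\<close> to avoid division.\<close>
  define w where "w = h z z *\<^sub>R y - h z y *\<^sub>R z"
  have "w \<noteq> 0"
  proof
    assume "w = 0"
    then have "h z z *\<^sub>R y \<in> span {z}"
      by (simp add: w_def span_base span_scale)
    from span_scale[OF this, of "1 / h z z"] show False
      using zz \<open>y \<notin> span {z}\<close> by simp
  qed
  then have "h w w > 0" using pos by blast
  moreover have "h w w = h z z * (h z z * h y y - (h z y)\<^sup>2)"
    by (simp add: w_def bil sym[of y z] algebra_simps power2_eq_square)
  ultimately show ?thesis
    using zz by (simp add: zero_less_mult_iff)
qed

lemma sect_nonassoc_square_zero: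
  assumes A: "euclidean_metrized_comm_algebra mul h"
    and "z \<noteq> 0" and zz: "mul z z = 0" and "y \<notin> span {z}"
  shows "sect_nonassoc mul h z y \<le> 0"
    and "sect_nonassoc mul h z y = 0 \<longleftrightarrow> mul z y = 0"
proof -
  have bil: "bilinear h" and sym: "\<And>x y. h x y = h y x" and pos: "\<And>x. x \<noteq> 0 \<Longrightarrow> h x x > 0"
    and comm: "mul y z = mul z y"
    using A by (auto simp: euclidean_metrized_comm_algebra_def comm_algebra_def)
  have K: "sect_nonassoc mul h z y =
      - h (mul z y) (mul z y) / (h z z * h y y - (h z y)\<^sup>2)"
    by (simp add: sect_nonassoc_def zz comm bilinear_lzero[OF bil])
  have D: "h z z * h y y - (h z y)\<^sup>2 > 0"
    by (rule gram_determinant_pos) (use bil sym pos assms in auto)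
  have "h (mul z y) (mul z y) \<ge> 0" "h (mul z y) (mul z y) = 0 \<longleftrightarrow> mul z y = 0"
    using pos[of "mul z y"] bilinear_lzero[OF bil, of "mul z y"] by fastforce+
  then show "sect_nonassoc mul h z y \<le> 0" "sect_nonassoc mul h z y = 0 \<longleftrightarrow> mul z y = 0"
    using D by (auto simp: K)
qed

lemma lin_indep_pair_not_in_span:
  assumes "z \<noteq> 0" and "y \<notin> span {z}"
  shows "lin_indep_pair z y"
  using assms span_base[of z "{z}"] independent_insertI[of y "{z}"]
  by (auto simp: lin_indep_pair_def insert_commute)

lemma exists_not_in_span_singleton:
  fixes z :: "'a::real_vector"
  assumes "dim (UNIV :: 'a set) \<ge> 2"
  obtains y where "y \<notin> span {z}"
proof -
  have "dim (span {z}) \<le> 1"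
    using dim_le_card[of "span {z}" "{z}"] by simp
  then have "span {z} \<noteq> UNIV" using assms by force
  then show ?thesis using that by blast
qed

text \<open>Vectors off the line through \<open>z\<close> are handled by the equality case of the sign estimate,
  vectors on the line by \<open>z \<circ> z = 0\<close> itself.\<close>

lemma square_zero_annihilates:
  assumes A: "euclidean_metrized_comm_algebra mul h"
    and N: "nonnegative_sect_nonassoc mul h"
    and "z \<noteq> 0" and zz: "mul z z = 0"
  shows "mul z y = 0"
proof (cases "y \<in> span {z}")
  case True
  then obtain c where "y = c *\<^sub>R z" by (auto simp: span_singleton)
  then show ?thesis
    using A zz by (simp add: euclidean_metrized_comm_algebra_def comm_algebra_def bilinear_rmul)
next
  case False
  have "sect_nonassoc mul h z y \<ge> 0"
    using N lin_indep_pair_not_in_span[OF \<open>z \<noteq> 0\<close> False]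
    by (simp add: nonnegative_sect_nonassoc_def)
  then show ?thesis
    using sect_nonassoc_square_zero[OF A \<open>z \<noteq> 0\<close> zz False] by simp
qed

text \<open>The part of \<open>S\<close> orthogonal to \<open>z\<close> is an ideal because
  \<open>h(z, x \<circ> y) = h(z \<circ> x, y) = 0\<close>. The same identity shows that it contains all products of
  elements of \<open>S\<close>, so it is nonzero and simplicity makes it all of \<open>S\<close>.\<close>

lemma annihilator_orthogonal_simple_ideal:
  assumes A: "euclidean_metrized_comm_algebra mul h"
    and ann: "\<And>x. mul z x = 0"
    and ideal: "alg_ideal mul UNIV S" and simple: "simple_algebra mul S"
    and "x \<in> S"
  shows "h z x = 0"
proof -
  have bil: "bilinear h" and inv: "\<And>x y z. h (mul x y) z = h x (mul y z)"
    using A by (auto simp: euclidean_metrized_comm_algebra_def)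
  have products: "h z (mul a b) = 0" for a b
    using inv[of z a b] by (simp add: ann bilinear_lzero[OF bil])
  define J where "J = {y \<in> S. h z y = 0}"
  have "subspace S" and closed: "\<And>a b. b \<in> S \<Longrightarrow> mul a b \<in> S \<and> mul b a \<in> S"
    using ideal by (auto simp: alg_ideal_def)
  then have "subspace J"
    by (auto simp: J_def subspace_def bilinear_rzero[OF bil] bilinear_radd[OF bil]
        bilinear_rmul[OF bil])
  then have "alg_ideal mul S J"
    using closed products by (auto simp: alg_ideal_def J_def)
  then have "J = {0} \<or> J = S"
    using simple by (simp add: simple_algebra_def)
  moreover obtain a b where "a \<in> S" "b \<in> S" "mul a b \<noteq> 0"
    using simple by (auto simp: simple_algebra_def)
  then have "mul a b \<in> J" using closed products by (simp add: J_def)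
  ultimately have "J = S" using \<open>mul a b \<noteq> 0\<close> by auto
  then show ?thesis using \<open>x \<in> S\<close> by (auto simp: J_def)
qed

lemma semisimple_annihilator_trivial:
  assumes A: "euclidean_metrized_comm_algebra mul h"
    and "semisimple_algebra mul" and ann: "\<And>x. mul z x = 0"
  shows "z = 0"
proof -
  have bil: "bilinear h" and pos: "\<And>x. x \<noteq> 0 \<Longrightarrow> h x x > 0"
    using A by (auto simp: euclidean_metrized_comm_algebra_def)
  obtain F where F: "\<And>I. I \<in> F \<Longrightarrow> alg_ideal mul UNIV I \<and> simple_algebra mul I"
    and sum: "internal_direct_sum F"
    using \<open>semisimple_algebra mul\<close> by (auto simp: semisimple_algebra_def)
  obtain c where c: "c \<in> (\<Pi>\<^sub>E I\<in>F. I)" and z: "z = (\<Sum>I\<in>F. c I)"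
    using sum unfolding internal_direct_sum_def by blast
  have "linear (h z)" using bil by (simp add: bilinear_def)
  then have "h z (\<Sum>I\<in>F. c I) = (\<Sum>I\<in>F. h z (c I))" by (rule linear_sum)
  also have "\<dots> = 0"
  proof (rule sum.neutral, rule ballI)
    fix I assume I: "I \<in> F"
    then have "c I \<in> I" using c by (auto dest: PiE_mem)
    with F[OF I] show "h z (c I) = 0"
      using annihilator_orthogonal_simple_ideal[OF A ann] by blast
  qed
  finally have "h z z = 0" by (simp flip: z)
  then show "z = 0" using pos by force
qed

theorem lemma8p5:
  fixes mul :: "'a::real_vector \<Rightarrow> 'a \<Rightarrow> 'a"
    and h :: "'a \<Rightarrow> 'a \<Rightarrow> real"
  assumes "euclidean_metrized_comm_algebra mul h"
  shows "(\<forall>z y. z \<noteq> 0 \<and> mul z z = 0 \<and> y \<noteq> 0 \<and> y \<notin> span {z} \<longrightarrow>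
            sect_nonassoc mul h z y \<le> 0 \<and>
            (sect_nonassoc mul h z y = 0 \<longleftrightarrow> mul z y = 0)) \<and>
         (positive_sect_nonassoc mul h \<or>
          (nonnegative_sect_nonassoc mul h \<and> semisimple_algebra mul) \<longrightarrow>
            \<not> (\<exists>z. z \<noteq> 0 \<and> mul z z = 0))"
proof (intro conjI impI notI)
  show "\<forall>z y. z \<noteq> 0 \<and> mul z z = 0 \<and> y \<noteq> 0 \<and> y \<notin> span {z} \<longrightarrow>
      sect_nonassoc mul h z y \<le> 0 \<and> (sect_nonassoc mul h z y = 0 \<longleftrightarrow> mul z y = 0)"
    using sect_nonassoc_square_zero[OF assms] by blast
next
  assume cond: "positive_sect_nonassoc mul h \<or>
      (nonnegative_sect_nonassoc mul h \<and> semisimple_algebra mul)"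
  assume "\<exists>z. z \<noteq> 0 \<and> mul z z = 0"
  then obtain z where z: "z \<noteq> 0" "mul z z = 0" by blast
  from cond show False
  proof (elim disjE conjE)
    assume P: "positive_sect_nonassoc mul h"
    then obtain y where y: "y \<notin> span {z}"
      using exists_not_in_span_singleton by (auto simp: positive_sect_nonassoc_def)
    have "sect_nonassoc mul h z y > 0"
      using P lin_indep_pair_not_in_span[OF z(1) y] by (simp add: positive_sect_nonassoc_def)
    then show False
      using sect_nonassoc_square_zero(1)[OF assms z y] by simp
  next
    assume "nonnegative_sect_nonassoc mul h" "semisimple_algebra mul"
    then show False
      using semisimple_annihilator_trivial[OF assms] square_zero_annihilates[OF assms] z by blast
  qed
qed

end
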